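(* Let $p>2$, $s>0$ and $L>0$. For any first-order method that performs $1\le N\le\frac{d-1}{2}$ iterations, there exists a regularized quadratic function $$f(x)=\tfrac12x^\top Ax-b^\top x+\tfrac sp\|x\|^p,\qquad x\in\mathbb{R}^d,$$ with $A\in\mathbb{R}^{d\times d}$ symmetric positive semidefinite, $b\in\mathbb{R}^d$, and $\lambda_{\max}(A)=L$, such that the functional residual at the result $x_N$ of the method applied to $f$ is bounded as $$f(x_N)-f_\star\ =\ \Omega\left(\Bigl[\frac{L}{s^{2/p}N^2}\Bigr]^{\frac{p}{p-2}}\right),$$ where $f_\star=\min_x f(x)$. And for minimizing the gradient norm, the following lower bound holds: $$\|\nabla f(x_N)\|\ =\ \Omega\left(\Bigl[\frac{L}{s^{1/(p-1)}N^2}\Bigr]^{\frac{p-1}{p-2}}\right).$$ Here $\Omega(\cdot)$ denotes a lower bound that hides an absolute numerical constant.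
   Context: A first-order method is a sequence of mappings $\mathcal M=(\mathcal M_0,\mathcal M_1,\ldots)$; applied to $f$ from $x_0=0$ it generates $x_{k+1}=\mathcal M_k(\mathcal I_f(x_0),\ldots,\mathcal I_f(x_k))$, where $\mathcal I_f(x)=\{f(x),\nabla f(x)\}$ is the first-order oracle. The result of the method after $N$ iterations is $x_N$. $\|\cdot\|$ is the Euclidean norm and $\lambda_{\max}$ the largest eigenvalue. *)

theory Defs
  imports Complex_Main "Jordan_Normal_Form.Spectral_Radius"
begin

text \<open>Euclidean space of dimension \<open>d\<close> is \<^term>\<open>carrier_vec d :: real vec set\<close>. A dimension in the
  term language, rather than a type, is needed because the constant in the lower bounds has to be
  chosen before \<open>d\<close>.\<close>

definition enorm :: "real vec \<Rightarrow> real" where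
  "enorm x = sqrt (x \<bullet> x)"

definition has_gradient :: "nat \<Rightarrow> (real vec \<Rightarrow> real) \<Rightarrow> real vec \<Rightarrow> real vec \<Rightarrow> bool" where
  "has_gradient d f x g \<longleftrightarrow> g \<in> carrier_vec d \<and>
     (\<forall>e>0. \<exists>r>0. \<forall>h\<in>carrier_vec d. enorm h < r \<longrightarrow>
        \<bar>f (x + h) - f x - g \<bullet> h\<bar> \<le> e * enorm h)"

definition gradient :: "nat \<Rightarrow> (real vec \<Rightarrow> real) \<Rightarrow> real vec \<Rightarrow> real vec" where
  "gradient d f x = (THE g. has_gradient d f x g)"

lemma enorm_smult: "enorm (a \<cdot>\<^sub>v h) = \<bar>a\<bar> * enorm h"
proof -
  have "(a \<cdot>\<^sub>v h) \<bullet> (a \<cdot>\<^sub>v h) = a\<^sup>2 * (h \<bullet> h)"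
    by (simp add: scalar_prod_def power2_eq_square sum_distrib_left algebra_simps)
  then show ?thesis by (simp add: enorm_def real_sqrt_mult)
qed

lemma has_gradient_unique:
  assumes "has_gradient d f x g" "has_gradient d f x g'"
  shows "g = g'"
proof (rule ccontr)
  assume ne: "g \<noteq> g'"
  have c: "g \<in> carrier_vec d" "g' \<in> carrier_vec d" using assms by (auto simp: has_gradient_def)
  define w where "w = g - g'"
  have w: "w \<in> carrier_vec d" using c by (simp add: w_def)
  obtain i where i: "i < d" "g $ i \<noteq> g' $ i" using ne c by (metis carrier_vecD eq_vecI)
  have "0 < (w $ i)\<^sup>2" using i c by (simp add: w_def)
  also have "\<dots> \<le> (\<Sum>j\<in>{0..<d}. (w $ j)\<^sup>2)" using i by (intro member_le_sum) auto
  also have "\<dots> = w \<bullet> w" using w by (simp add: scalar_prod_def power2_eq_square)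
  finally have pos: "0 < w \<bullet> w" .
  define e where "e = enorm w / 4"
  have nw: "enorm w > 0" and nw2: "enorm w * enorm w = w \<bullet> w" using pos by (auto simp: enorm_def)
  have e: "e > 0" using nw by (simp add: e_def)
  obtain r where r: "r > 0" "\<And>h. h \<in> carrier_vec d \<Longrightarrow> enorm h < r \<Longrightarrow>
      \<bar>f (x + h) - f x - g \<bullet> h\<bar> \<le> e * enorm h"
    using assms(1) e by (auto simp: has_gradient_def)
  obtain r' where r': "r' > 0" "\<And>h. h \<in> carrier_vec d \<Longrightarrow> enorm h < r' \<Longrightarrow>
      \<bar>f (x + h) - f x - g' \<bullet> h\<bar> \<le> e * enorm h"
    using assms(2) e by (auto simp: has_gradient_def)
  define t where "t = min r r' / (2 * enorm w)"
  have t: "t > 0" using r r' nw by (simp add: t_def)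
  define h where "h = t \<cdot>\<^sub>v w"
  have h: "h \<in> carrier_vec d" using w by (simp add: h_def)
  have nh: "enorm h = t * enorm w" using t by (simp add: h_def enorm_smult)
  also have "\<dots> = min r r' / 2" using nw by (simp add: t_def)
  finally have "enorm h < r" "enorm h < r'" using r r' by auto
  then have "\<bar>g \<bullet> h - g' \<bullet> h\<bar> \<le> 2 * e * enorm h" using r(2)[OF h] r'(2)[OF h] by linarith
  moreover have "g \<bullet> h - g' \<bullet> h = t * (w \<bullet> w)"
    using c w by (simp add: h_def w_def minus_scalar_prod_distrib[of _ d] right_diff_distrib
        scalar_prod_smult_distrib[of _ d])
  ultimately have "t * (enorm w * enorm w) \<le> 2 * (enorm w / 4) * (t * enorm w)"
    by (simp add: nh nw2 e_def)
  then have "t * (enorm w * enorm w) \<le> 0" by (simp add: algebra_simps)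
  then show False using t nw by (simp add: mult_le_0_iff)
qed

lemma gradient_eq: "has_gradient d f x g \<Longrightarrow> gradient d f x = g"
  unfolding gradient_def by (blast intro: the_equality has_gradient_unique)

definition reg_quadratic :: "real mat \<Rightarrow> real vec \<Rightarrow> real \<Rightarrow> real \<Rightarrow> real vec \<Rightarrow> real" where
  "reg_quadratic A b s p x = 1 / 2 * (x \<bullet> (A *\<^sub>v x)) - b \<bullet> x + s / p * enorm x powr p"

definition pos_semidef :: "nat \<Rightarrow> real mat \<Rightarrow> bool" where
  "pos_semidef d A \<longleftrightarrow> A \<in> carrier_mat d d \<and> transpose_mat A = A \<and>
     (\<forall>x\<in>carrier_vec d. 0 \<le> x \<bullet> (A *\<^sub>v x))"

definition lambda_max :: "real mat \<Rightarrow> real" where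
  "lambda_max A = Max (spectrum A)"

text \<open>A method is a sequence of maps: the \<open>k\<close>-th one receives the \<open>k + 1\<close> pairs
  (function value, gradient) collected so far, and returns the next query point.\<close>

type_synonym fo_method = "nat \<Rightarrow> (real \<times> real vec) list \<Rightarrow> real vec"

definition first_order_method :: "nat \<Rightarrow> fo_method \<Rightarrow> bool" where
  "first_order_method d M \<longleftrightarrow>
     (\<forall>k hs. length hs = Suc k \<longrightarrow> snd ` set hs \<subseteq> carrier_vec d \<longrightarrow> M k hs \<in> carrier_vec d)"

definition fo_info :: "nat \<Rightarrow> (real vec \<Rightarrow> real) \<Rightarrow> real vec \<Rightarrow> real \<times> real vec" where
  "fo_info d f x = (f x, gradient d f x)"

fun iterate :: "nat \<Rightarrow> fo_method \<Rightarrow> (real vec \<Rightarrow> real) \<Rightarrow> nat \<Rightarrow> real vec" where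
  "iterate d M f 0 = 0\<^sub>v d"
| "iterate d M f (Suc k) = M k (map (\<lambda>i. fo_info d f (iterate d M f i)) [0..<Suc k])"

end

theory Submission
  imports Defs
begin

text \<open>Put \<open>\<mu> = L / N\<^sup>2\<close> and \<open>R = (\<mu> / s)\<^bsup>1/(p-2)\<^esup>\<close>. If a minimizer \<open>y\<close> has norm \<open>R\<close>, then the regularizer
  alone makes the objective behave at \<open>y\<close> like a \<open>\<mu>\<close>-strongly convex function:
  \<open>f(x) - f(y) \<ge> \<mu>/2 \<parallel>x - y\<parallel>\<^sup>2\<close> and \<open>\<parallel>\<nabla>f(x)\<parallel> \<ge> \<mu>/2 \<parallel>x - y\<parallel>\<close>. The two bounds of the theorem are \<open>\<mu> R\<^sup>2\<close>
  and \<open>\<mu> R\<close> up to constants, so it suffices to keep \<open>x\<^sub>N\<close> at distance proportional to \<open>R\<close> from \<open>y\<close>.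

  The matrix couples orthonormal vectors \<open>v\<^sub>0, \<dots>, v\<^sub>N\<close> along a chain and is \<open>L\<close> times the identity on their
  complement, which is nontrivial and gives the largest eigenvalue; \<open>b\<close> is a multiple of \<open>v\<^sub>0\<close>. An oracle answer
  at a point orthogonal to \<open>v\<^sub>k, \<dots>, v\<^sub>N\<close> depends on \<open>v\<^sub>0, \<dots>, v\<^sub>k\<close> only, so \<open>v\<^sub>k\<close> can be chosen after \<open>x\<^sub>k\<close>
  is known and orthogonal to \<open>x\<^sub>1, \<dots>, x\<^sub>k\<close>: this is where \<open>2N + 1 \<le> d\<close> enters. In the end \<open>x\<^sub>N\<close> is orthogonal
  to \<open>v\<^sub>N\<close> alone, so this single coordinate of \<open>y\<close> has to carry a constant fraction of \<open>R\<close>. For this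
  the last node of the chain is given a mass of order \<open>N\<close>.\<close>

section \<open>Euclidean geometry of vectors\<close>

lemma scalar_prod_self_nonneg: "0 \<le> (x :: real vec) \<bullet> x"
  by (auto simp: scalar_prod_def intro: sum_nonneg)

lemma enorm_nonneg: "0 \<le> enorm x"
  by (simp add: enorm_def scalar_prod_self_nonneg)

lemma enorm_square: "(enorm x)\<^sup>2 = x \<bullet> x"
  by (simp add: enorm_def scalar_prod_self_nonneg)

lemma scalar_prod_self_eq_0:
  assumes "x \<in> carrier_vec d" "(x :: real vec) \<bullet> x = 0"
  shows "x = 0\<^sub>v d"
proof (rule eq_vecI)
  fix i assume i: "i < dim_vec (0\<^sub>v d :: real vec)"
  have "(\<Sum>i\<in>{0..<d}. x $ i * x $ i) = 0" using assms by (simp add: scalar_prod_def)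
  then have "x $ i * x $ i = 0" using i by (subst (asm) sum_nonneg_eq_0_iff) auto
  then show "x $ i = 0\<^sub>v d $ i" using i by simp
qed (use assms in simp)

lemma scalar_prod_diff_self:
  assumes "x \<in> carrier_vec d" "y \<in> carrier_vec d"
  shows "(x - y) \<bullet> (x - y) = x \<bullet> x - 2 * (x \<bullet> y) + y \<bullet> (y :: real vec)"
  using assms comm_scalar_prod[of x d y]
  by (simp add: minus_scalar_prod_distrib[of _ d] scalar_prod_minus_distrib[of _ d])

lemma scalar_prod_add_self:
  assumes "x \<in> carrier_vec d" "y \<in> carrier_vec d"
  shows "(x + y) \<bullet> (x + y) = x \<bullet> x + 2 * (x \<bullet> y) + y \<bullet> (y :: real vec)"
  using assms comm_scalar_prod[of x d y]
  by (simp add: add_scalar_prod_distrib[of _ d] scalar_prod_add_distrib[of _ d])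

lemma scalar_prod_Cauchy_Schwarz:
  assumes x: "x \<in> carrier_vec d" and y: "y \<in> carrier_vec d"
  shows "\<bar>x \<bullet> y\<bar> \<le> enorm x * enorm y"
proof (cases "y \<bullet> y = 0")
  case True
  then have "y = 0\<^sub>v d" using y by (intro scalar_prod_self_eq_0)
  then show ?thesis using x by (simp add: enorm_nonneg)
next
  case False
  then have pos: "y \<bullet> y > 0" using scalar_prod_self_nonneg[of y] by simp
  let ?a = "y \<bullet> y" and ?b = "x \<bullet> y"
  have "0 \<le> (?a \<cdot>\<^sub>v x - ?b \<cdot>\<^sub>v y) \<bullet> (?a \<cdot>\<^sub>v x - ?b \<cdot>\<^sub>v y)" by (rule scalar_prod_self_nonneg)
  also have "\<dots> = ?a * (?a * (x \<bullet> x) - ?b\<^sup>2)"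
    using x y by (subst scalar_prod_diff_self[of _ d]) (auto simp: power2_eq_square algebra_simps)
  finally have "?b\<^sup>2 \<le> ?a * (x \<bullet> x)" using pos by (simp add: zero_le_mult_iff)
  then have "?b\<^sup>2 \<le> (enorm x * enorm y)\<^sup>2" by (simp add: power_mult_distrib enorm_square mult.commute)
  then show ?thesis by (simp add: power2_le_iff_abs_le enorm_nonneg)
qed

lemma vec_eq_by_scalar_prod:
  assumes "x \<in> carrier_vec d" "x' \<in> carrier_vec d"
    and "\<And>y. y \<in> carrier_vec d \<Longrightarrow> y \<bullet> x = y \<bullet> (x' :: real vec)"
  shows "x = x'"
proof (rule eq_vecI)
  fix i assume "i < dim_vec x'"
  then show "x $ i = x' $ i" using assms(3)[of "unit_vec d i"] assms(1,2) by simp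
qed (use assms in simp)

text \<open>Padding \<open>W\<close> with zero rows to a square matrix leaves at least one zero row,
  so the determinant vanishes and a kernel vector exists; normalizing it gives
  \<open>v\<close>.\<close>

lemma exists_unit_orthogonal:
  assumes W: "set W \<subseteq> carrier_vec d" and len: "length W < d"
  shows "\<exists>v \<in> carrier_vec d. v \<bullet> v = (1::real) \<and> (\<forall>w \<in> set W. w \<bullet> v = 0)"
proof -
  define B where "B = mat\<^sub>r d d (\<lambda>i. if i < length W then W ! i else 0\<^sub>v d)"
  have rows: "row B i = (if i < length W then W ! i else 0\<^sub>v d)" if "i < d" for i
    using that W by (auto simp: B_def subset_iff intro!: row_mat_of_row_fun)
  have B: "B \<in> carrier_mat d d" by (simp add: B_def)
  \<comment> \<open>Row \<open>length W\<close> is the first padding row; singling it out gives the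
    form that \<open>det_row_0\<close> expects.\<close>
  have "B = mat\<^sub>r d d (\<lambda>i. if i = length W then 0\<^sub>v d else row B i)"
    by (rule eq_rowI) (use W len B rows in \<open>auto simp: subset_iff\<close>)
  also have "det \<dots> = 0"
    using B len by (intro det_row_0) auto
  finally obtain u where u: "u \<in> carrier_vec d" "u \<noteq> 0\<^sub>v d" "B *\<^sub>v u = 0\<^sub>v d"
    using det_0_iff_vec_prod_zero_field[OF B] by auto
  have pos: "u \<bullet> u > 0"
    using u scalar_prod_self_nonneg[of u] scalar_prod_self_eq_0[of u d] by force
  have orth: "w \<bullet> u = 0" if "w \<in> set W" for w
  proof -
    obtain i where i: "i < length W" "w = W ! i" using \<open>w \<in> set W\<close> by (auto simp: in_set_conv_nth)
    then have "w \<bullet> u = (B *\<^sub>v u) $ i" using rows[of i] len B by simp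
    then show ?thesis using u i len by simp
  qed
  let ?v = "(1 / enorm u) \<cdot>\<^sub>v u"
  have "?v \<bullet> ?v = 1"
    using pos u by (simp add: enorm_def)
  moreover have "w \<bullet> ?v = 0" if "w \<in> set W" for w
    using orth[OF that] that W u by (subst scalar_prod_smult_distrib[of _ d]) auto
  ultimately show ?thesis using u by (intro bexI[of _ ?v]) auto
qed

section \<open>Orthonormal families and their linear combinations\<close>

definition orthonormal :: "nat \<Rightarrow> nat \<Rightarrow> (nat \<Rightarrow> real vec) \<Rightarrow> bool" where
  "orthonormal d n V \<longleftrightarrow> (\<forall>i<n. V i \<in> carrier_vec d) \<and>
     (\<forall>i<n. \<forall>j<n. V i \<bullet> V j = (if i = j then 1 else 0))"

lemma exists_orthonormal_orthogonal:
  assumes "set W \<subseteq> carrier_vec d" and "length W + n \<le> d"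
  shows "\<exists>E. orthonormal d n E \<and> (\<forall>i<n. \<forall>w \<in> set W. w \<bullet> E i = 0)"
  using assms(2)
proof (induction n)
  case 0
  show ?case by (simp add: orthonormal_def)
next
  case (Suc n)
  then obtain E where E: "orthonormal d n E" "\<And>i w. i < n \<Longrightarrow> w \<in> set W \<Longrightarrow> w \<bullet> E i = 0"
    by auto
  have Ec: "E i \<in> carrier_vec d" if "i < n" for i using E(1) that by (simp add: orthonormal_def)
  obtain v where v: "v \<in> carrier_vec d" "v \<bullet> v = 1" "\<forall>w \<in> set (W @ map E [0..<n]). w \<bullet> v = 0"
    using exists_unit_orthogonal[of "W @ map E [0..<n]" d] assms(1) Ec Suc.prems by (auto simp: image_subset_iff)
  have vE: "E i \<bullet> v = 0" "v \<bullet> E i = 0" if "i < n" for i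
    using that v(3) comm_scalar_prod[OF v(1) Ec[OF that]] by auto
  show ?case
    by (rule exI[of _ "E(n := v)"])
      (use E v vE in \<open>auto simp: orthonormal_def less_Suc_eq\<close>)
qed

lemma orthonormal_carrier: "orthonormal d n V \<Longrightarrow> i < n \<Longrightarrow> V i \<in> carrier_vec d"
  by (simp add: orthonormal_def)

definition lin_sum :: "nat \<Rightarrow> nat \<Rightarrow> (nat \<Rightarrow> real) \<Rightarrow> (nat \<Rightarrow> real vec) \<Rightarrow> real vec" where
  "lin_sum d n a V = vec d (\<lambda>k. \<Sum>i<n. a i * V i $ k)"

lemma lin_sum_carrier [simp]: "lin_sum d n a V \<in> carrier_vec d"
  by (simp add: lin_sum_def)

lemma scalar_prod_lin_sum:
  assumes "y \<in> carrier_vec d" "\<And>i. i < n \<Longrightarrow> V i \<in> carrier_vec d"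
  shows "y \<bullet> lin_sum d n a V = (\<Sum>i<n. a i * (V i \<bullet> y))"
proof -
  have "y \<bullet> lin_sum d n a V = (\<Sum>k\<in>{0..<d}. \<Sum>i<n. a i * (V i $ k * y $ k))"
    by (auto simp: scalar_prod_def lin_sum_def sum_distrib_left intro!: sum.cong)
  also have "\<dots> = (\<Sum>i<n. \<Sum>k\<in>{0..<d}. a i * (V i $ k * y $ k))"
    by (rule sum.swap)
  finally show ?thesis using assms by (simp add: scalar_prod_def sum_distrib_left)
qed

lemma orthonormal_coordinate:
  assumes "orthonormal d n V" "j < n"
  shows "V j \<bullet> lin_sum d n a V = a j"
proof -
  have "V j \<bullet> lin_sum d n a V = (\<Sum>i<n. a i * (V i \<bullet> V j))"
    using assms by (intro scalar_prod_lin_sum) (auto simp: orthonormal_def)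
  also have "\<dots> = (\<Sum>i<n. if i = j then a i else 0)"
    using assms by (intro sum.cong) (auto simp: orthonormal_def)
  finally show ?thesis using assms(2) by simp
qed

lemma lin_sum_scalar_prod_self:
  assumes "orthonormal d n V"
  shows "lin_sum d n a V \<bullet> lin_sum d n a V = (\<Sum>i<n. (a i)\<^sup>2)"
  using assms by (subst scalar_prod_lin_sum)
    (auto simp: orthonormal_coordinate orthonormal_carrier power2_eq_square)

lemma Bessel_inequality:
  assumes V: "orthonormal d n V" and x: "x \<in> carrier_vec d"
  shows "(\<Sum>i<n. (V i \<bullet> x)\<^sup>2) \<le> x \<bullet> x"
proof -
  define w where "w = lin_sum d n (\<lambda>i. V i \<bullet> x) V"
  have w: "w \<in> carrier_vec d" by (simp add: w_def)
  have "0 \<le> (x - w) \<bullet> (x - w)" by (rule scalar_prod_self_nonneg)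
  also have "\<dots> = x \<bullet> x - 2 * (x \<bullet> w) + w \<bullet> w" by (rule scalar_prod_diff_self[OF x w])
  also have "x \<bullet> w = (\<Sum>i<n. (V i \<bullet> x)\<^sup>2)"
    using x V unfolding w_def
    by (subst scalar_prod_lin_sum) (auto simp: orthonormal_carrier power2_eq_square)
  also have "w \<bullet> w = (\<Sum>i<n. (V i \<bullet> x)\<^sup>2)"
    unfolding w_def by (rule lin_sum_scalar_prod_self[OF V])
  finally show ?thesis by simp
qed

section \<open>Regularized quadratic functions\<close>

text \<open>This is convexity of the power function on the closed half-line, obtained from the mean
  value theorem and monotonicity of the derivative.\<close>

lemma powr_tangent_le:
  fixes a t u :: real
  assumes a: "a > 1" and t: "t \<ge> 0" and u: "u \<ge> 0"
  shows "t powr a + a * t powr (a - 1) * (u - t) \<le> u powr a"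
proof -
  have D: "((\<lambda>x. x powr a) has_real_derivative a * x powr (a - 1)) (at x)" if "x > 0" for x
    using that by (rule has_real_derivative_powr)
  consider "t = 0" | "u = 0" "t > 0" | "t > 0" "u > t" | "u > 0" "t > u" | "u = t" using t u by linarith
  then show ?thesis
  proof cases
    \<comment> \<open>The derivative rule holds at positive points only, so the mean value theorem
      does not reach the endpoint 0; the inequality is computed directly there.\<close>
    case 2
    then have "t powr a = t powr (a - 1) * t" by (simp add: powr_diff)
    then have "t powr a + a * t powr (a - 1) * (u - t) = (1 - a) * t powr a"
      using 2 by (simp add: algebra_simps)
    also have "\<dots> \<le> 0" using a by (simp add: mult_nonpos_nonneg)
    finally show ?thesis using powr_ge_zero order_trans by blast
  next
    case 3
    obtain z where z: "t < z" "z < u" "u powr a - t powr a = (u - t) * (a * z powr (a - 1))"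
      using MVT2[of t u "\<lambda>x. x powr a" "\<lambda>x. a * x powr (a - 1)"] D 3 by force
    have "(u - t) * (a * t powr (a - 1)) \<le> (u - t) * (a * z powr (a - 1))"
      using 3 a z by (intro mult_left_mono powr_mono2) auto
    then show ?thesis using z by (simp add: algebra_simps)
  next
    case 4
    obtain z where z: "u < z" "z < t" "t powr a - u powr a = (t - u) * (a * z powr (a - 1))"
      using MVT2[of u t "\<lambda>x. x powr a" "\<lambda>x. a * x powr (a - 1)"] D 4 by force
    have "(t - u) * (a * z powr (a - 1)) \<le> (t - u) * (a * t powr (a - 1))"
      using 4 a z by (intro mult_left_mono powr_mono2) auto
    then show ?thesis using z by (simp add: algebra_simps)
  qed (use a in auto)
qed

lemma powr_continuous_nonneg:
  fixes t q e :: real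
  assumes "t \<ge> 0" "q > 0" "e > 0"
  shows "\<exists>r>0. \<forall>u\<ge>0. \<bar>u - t\<bar> < r \<longrightarrow> \<bar>u powr q - t powr q\<bar> < e"
proof -
  have "((\<lambda>u. u powr q) \<longlongrightarrow> t powr q) (at t within {0..})"
    using assms by (intro tendsto_powr') (auto simp: eventually_at_filter)
  then have "\<forall>\<^sub>F u in at t within {0..}. dist (u powr q) (t powr q) < e"
    using assms(3) by (rule tendstoD)
  then obtain r where "r > 0" "\<And>u. u \<ge> 0 \<Longrightarrow> u \<noteq> t \<Longrightarrow> \<bar>u - t\<bar> < r \<Longrightarrow> \<bar>u powr q - t powr q\<bar> < e"
    by (auto simp: eventually_at dist_real_def)
  then show ?thesis using assms(3) by (metis abs_zero diff_self)
qed

definition reg_gradient :: "real mat \<Rightarrow> real vec \<Rightarrow> real \<Rightarrow> real \<Rightarrow> real vec \<Rightarrow> real vec" where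
  "reg_gradient A b s p x = (A *\<^sub>v x - b) + (s * enorm x powr (p - 2)) \<cdot>\<^sub>v x"

lemma reg_gradient_carrier:
  assumes "A \<in> carrier_mat d d" "b \<in> carrier_vec d" "x \<in> carrier_vec d"
  shows "reg_gradient A b s p x \<in> carrier_vec d"
  using assms by (auto simp: reg_gradient_def)

lemma enorm_powr: "enorm x powr q = (x \<bullet> x) powr (q / 2)"
  by (simp add: enorm_def powr_half_sqrt[symmetric] scalar_prod_self_nonneg powr_powr)

text \<open>The p-th power of the norm is a power of \<open>t = x \<bullet> x\<close> with exponent
  \<open>p / 2 > 1\<close>, and \<open>u - t\<close> is exactly
  \<open>2 * (x \<bullet> h) + h \<bullet> h\<close>. Linearizing in \<open>t\<close> leaves the
  tangent error of a convex scalar function as the only nonpolynomial remainder. The identity is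
  exact and serves both strong convexity and differentiability.\<close>

lemma reg_quadratic_expansion:
  assumes A: "pos_semidef d A" and b: "b \<in> carrier_vec d" and p: "p > 2"
    and x: "x \<in> carrier_vec d" and h: "h \<in> carrier_vec d"
  defines "t \<equiv> x \<bullet> x" and "u \<equiv> (x + h) \<bullet> (x + h)"
  shows "reg_quadratic A b s p (x + h) = reg_quadratic A b s p x + reg_gradient A b s p x \<bullet> h
    + 1 / 2 * (h \<bullet> (A *\<^sub>v h)) + s / 2 * t powr (p / 2 - 1) * (h \<bullet> h)
    + s / p * (u powr (p / 2) - t powr (p / 2) - p / 2 * t powr (p / 2 - 1) * (u - t))"
proof -
  have Ac: "A \<in> carrier_mat d d" and sym: "transpose_mat A = A"
    using A by (auto simp: pos_semidef_def)
  have Ax: "A *\<^sub>v x \<in> carrier_vec d" "A *\<^sub>v h \<in> carrier_vec d" using Ac x h by auto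
  have "h \<bullet> (A *\<^sub>v x) = (A *\<^sub>v x) \<bullet> h" using comm_scalar_prod[OF h Ax(1)] .
  also have "\<dots> = x \<bullet> (A *\<^sub>v h)"
    using transpose_vec_mult_scalar[OF Ac h x] sym by simp
  finally have sym': "x \<bullet> (A *\<^sub>v h) = (A *\<^sub>v x) \<bullet> h" "h \<bullet> (A *\<^sub>v x) = (A *\<^sub>v x) \<bullet> h"
    using comm_scalar_prod[OF h Ax(1)] by auto
  have quad: "(x + h) \<bullet> (A *\<^sub>v (x + h)) = x \<bullet> (A *\<^sub>v x) + 2 * ((A *\<^sub>v x) \<bullet> h) + h \<bullet> (A *\<^sub>v h)"
    using x h Ac Ax sym'
    by (simp add: mult_add_distrib_mat_vec[OF Ac] add_scalar_prod_distrib[of _ d]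
        scalar_prod_add_distrib[of _ d])
  have lin: "b \<bullet> (x + h) = b \<bullet> x + b \<bullet> h" using b x h by (rule scalar_prod_add_distrib)
  have g: "reg_gradient A b s p x \<bullet> h
      = (A *\<^sub>v x) \<bullet> h - b \<bullet> h + s * t powr (p / 2 - 1) * (x \<bullet> h)"
    using Ax b x h
    by (simp add: reg_gradient_def add_scalar_prod_distrib[of _ d] minus_scalar_prod_distrib[of _ d]
        enorm_powr t_def diff_divide_distrib)
  have ut: "u - t = 2 * (x \<bullet> h) + h \<bullet> h"
    using scalar_prod_add_self[OF x h] by (simp add: u_def t_def)
  have "s / p * (p / 2 * t powr (p / 2 - 1) * (u - t)) =
      s * t powr (p / 2 - 1) * (x \<bullet> h) + s / 2 * t powr (p / 2 - 1) * (h \<bullet> h)"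
    using p by (simp add: ut field_simps)
  then show ?thesis
    unfolding reg_quadratic_def quad lin g enorm_powr u_def[symmetric] t_def[symmetric]
    by (simp add: algebra_simps)
qed

text \<open>Two nonnegative remainders of the expansion are dropped: the quadratic form of
  \<open>A\<close> and the tangent error. The modulus that is kept depends on the base point
  \<open>x\<close>.\<close>

lemma reg_quadratic_lower_bound:
  assumes A: "pos_semidef d A" and b: "b \<in> carrier_vec d" and p: "p > 2" and s: "s > 0"
    and x: "x \<in> carrier_vec d" and z: "z \<in> carrier_vec d"
  shows "reg_quadratic A b s p x + reg_gradient A b s p x \<bullet> (z - x)
      + s * enorm x powr (p - 2) / 2 * ((z - x) \<bullet> (z - x)) \<le> reg_quadratic A b s p z"
proof -
  define h where "h = z - x"
  have h: "h \<in> carrier_vec d" and z': "z = x + h" using x z by (auto simp: h_def)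
  let ?t = "x \<bullet> x" and ?u = "(x + h) \<bullet> (x + h)"
  have "?t powr (p / 2) + p / 2 * ?t powr (p / 2 - 1) * (?u - ?t) \<le> ?u powr (p / 2)"
    using p by (intro powr_tangent_le) (auto simp: scalar_prod_self_nonneg)
  then have "0 \<le> s / p * (?u powr (p / 2) - ?t powr (p / 2) - p / 2 * ?t powr (p / 2 - 1) * (?u - ?t))"
    using s p by simp
  moreover have "0 \<le> h \<bullet> (A *\<^sub>v h)" using A h by (simp add: pos_semidef_def)
  moreover have "s * enorm x powr (p - 2) / 2 * (h \<bullet> h) = s / 2 * ?t powr (p / 2 - 1) * (h \<bullet> h)"
    by (simp add: enorm_powr diff_divide_distrib)
  ultimately show ?thesis
    using reg_quadratic_expansion[OF A b p x h, of s] unfolding h_def[symmetric] unfolding z' by linarith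
qed

text \<open>The remainder of the expansion is nonnegative. Its quadratic terms are at most
  \<open>C\<close> times the squared norm of \<open>h\<close>; the tangent error is at most a slope
  difference times \<open>u - t\<close>, hence of smaller order than the norm of
  \<open>h\<close>.\<close>

lemma has_gradient_reg_quadratic:
  assumes A: "pos_semidef d A" and b: "b \<in> carrier_vec d" and p: "p > 2" and s: "s > 0"
    and bound: "\<And>h. h \<in> carrier_vec d \<Longrightarrow> h \<bullet> (A *\<^sub>v h) \<le> L * (h \<bullet> h)"
    and L: "L \<ge> 0" and x: "x \<in> carrier_vec d"
  shows "has_gradient d (reg_quadratic A b s p) x (reg_gradient A b s p x)"
  unfolding has_gradient_def
proof (intro conjI allI impI)
  have "A \<in> carrier_mat d d" using A by (simp add: pos_semidef_def)
  then show "reg_gradient A b s p x \<in> carrier_vec d" using b x by (rule reg_gradient_carrier)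
next
  fix e :: real assume e: "e > 0"
  define t q where "t = x \<bullet> x" and "q = p / 2 - 1"
  \<comment> \<open>\<open>K\<close> will bound \<open>u - t\<close> relative to the norm of
    \<open>h\<close>, and \<open>C\<close> collects the quadratic coefficients. \<open>D\<close>
    exceeds \<open>C\<close> by 1 so that division by it is safe even when \<open>C\<close> is
    0.\<close>
  define K where "K = 2 * enorm x + 1"
  define C where "C = L / 2 + s / 2 * t powr q"
  define D where "D = C + 1"
  have t: "t \<ge> 0" and q: "q > 0" and K: "K > 0" and C: "C \<ge> 0"
    using p s L by (auto simp: t_def q_def K_def C_def scalar_prod_self_nonneg add_nonneg_pos enorm_nonneg)
  have D: "D > 0" "C \<le> D" using C by (auto simp: D_def)
  have "e / (s * K) > 0" using e s K by simp
  then obtain r where r: "r > 0"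
      "\<And>u. u \<ge> 0 \<Longrightarrow> \<bar>u - t\<bar> < r \<Longrightarrow> \<bar>u powr q - t powr q\<bar> < e / (s * K)"
    using powr_continuous_nonneg[OF t q] by blast
  \<comment> \<open>The three bounds serve in turn to replace the square of the norm of
    \<open>h\<close> by the norm, to keep \<open>u\<close> within \<open>r\<close> of
    \<open>t\<close>, and to hold the quadratic terms below half of the allowance.\<close>
  define \<delta> where "\<delta> = min 1 (min (r / K) (e / (2 * D)))"
  have "\<delta> > 0" using r K e D by (simp add: \<delta>_def)
  moreover have "\<bar>reg_quadratic A b s p (x + h) - reg_quadratic A b s p x - reg_gradient A b s p x \<bullet> h\<bar>
      \<le> e * enorm h" if h: "h \<in> carrier_vec d" and small: "enorm h < \<delta>" for h
  proof -
    define u where "u = (x + h) \<bullet> (x + h)"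
    define n where "n = enorm h"
    have n: "n \<ge> 0" "n \<le> 1" "n < r / K" "n < e / (2 * D)" and hh: "h \<bullet> h = n * n"
      using small enorm_nonneg[of h] enorm_square[of h] by (auto simp: n_def \<delta>_def power2_eq_square)
    have u: "u \<ge> 0" by (simp add: u_def scalar_prod_self_nonneg)
    have ut: "u - t = 2 * (x \<bullet> h) + n * n"
      using scalar_prod_add_self[OF x h] hh by (simp add: u_def t_def)
    have "\<bar>u - t\<bar> \<le> 2 * \<bar>x \<bullet> h\<bar> + n * n" using n unfolding ut by (simp add: abs_triangle_ineq[THEN order_trans])
    also have "\<dots> \<le> 2 * (enorm x * n) + 1 * n"
      using scalar_prod_Cauchy_Schwarz[OF x h] n by (intro add_mono mult_mono) (auto simp: n_def)
    also have "\<dots> = K * n" by (simp add: K_def algebra_simps)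
    finally have ut_le: "\<bar>u - t\<bar> \<le> K * n" .
    also have "K * n < r" using n K by (simp add: field_simps)
    finally have close: "\<bar>u powr q - t powr q\<bar> < e / (s * K)" using r(2) u by blast
    let ?E = "u powr (p / 2) - t powr (p / 2) - p / 2 * t powr q * (u - t)"
    have "t powr (p / 2) + p / 2 * t powr q * (u - t) \<le> u powr (p / 2)"
      using powr_tangent_le[of "p / 2" t u] p t u by (simp add: q_def)
    then have E0: "0 \<le> ?E" by simp
    \<comment> \<open>The tangent is now taken at \<open>u\<close> instead of \<open>t\<close>,
      which bounds the error from above by a difference of slopes.\<close>
    have "u powr (p / 2) + p / 2 * u powr q * (t - u) \<le> t powr (p / 2)"
      using powr_tangent_le[of "p / 2" u t] p t u by (simp add: q_def)
    then have "?E \<le> p / 2 * ((u powr q - t powr q) * (u - t))"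
      by (simp add: field_simps)
    also have "(u powr q - t powr q) * (u - t) \<le> \<bar>u powr q - t powr q\<bar> * \<bar>u - t\<bar>"
      by (metis abs_ge_self abs_mult)
    also have "\<dots> \<le> e / (s * K) * (K * n)"
      using close ut_le e s K by (intro mult_mono) auto
    finally have "?E \<le> p / 2 * (e / (s * K) * (K * n))" using p by simp
    then have "s / p * ?E \<le> s / p * (p / 2 * (e / (s * K) * (K * n)))"
      using s p by (intro mult_left_mono) auto
    also have "\<dots> = e / 2 * n" using s p K by (simp add: field_simps)
    finally have E1: "s / p * ?E \<le> e / 2 * n" .
    have Ah: "0 \<le> h \<bullet> (A *\<^sub>v h)" "h \<bullet> (A *\<^sub>v h) \<le> L * (n * n)"
      using A h bound[OF h] hh by (auto simp: pos_semidef_def)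
    have "C * n \<le> e / 2"
    proof -
      have "C * n \<le> D * (e / (2 * D))" using n C D by (intro mult_mono) auto
      also have "\<dots> = e / 2" using D by simp
      finally show ?thesis .
    qed
    then have "C * n * n \<le> e / 2 * n" using n by (intro mult_right_mono) auto
    then have quad: "L / 2 * (n * n) + s / 2 * t powr q * (n * n) \<le> e / 2 * n"
      by (simp add: C_def algebra_simps)
    have "reg_quadratic A b s p (x + h) - reg_quadratic A b s p x - reg_gradient A b s p x \<bullet> h
      = 1 / 2 * (h \<bullet> (A *\<^sub>v h)) + s / 2 * t powr q * (n * n) + s / p * ?E"
      using reg_quadratic_expansion[OF A b p x h, of s] hh by (simp add: u_def t_def q_def)
    moreover have "0 \<le> s / p * ?E" "0 \<le> s / 2 * t powr q * (n * n)" using E0 s p n by auto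
    ultimately show ?thesis using Ah quad E1 unfolding n_def[symmetric] by (simp add: abs_le_iff)
  qed
  ultimately show "\<exists>r>0. \<forall>h\<in>carrier_vec d. enorm h < r \<longrightarrow>
      \<bar>reg_quadratic A b s p (x + h) - reg_quadratic A b s p x - reg_gradient A b s p x \<bullet> h\<bar> \<le> e * enorm h"
    by blast
qed

text \<open>The lower bound based at \<open>y\<close>, where the linear term vanishes, gives the
  first claim. Based at \<open>x\<close> and evaluated at \<open>y\<close>, it bounds the gap by
  minus the gradient at \<open>x\<close> paired with \<open>y - x\<close>; Cauchy-Schwarz then gives
  the second.\<close>

lemma stationary_residual_bounds:
  assumes A: "pos_semidef d A" and b: "b \<in> carrier_vec d" and p: "p > 2" and s: "s > 0"
    and x: "x \<in> carrier_vec d" and y: "y \<in> carrier_vec d"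
    and stat: "reg_gradient A b s p y = 0\<^sub>v d"
  defines "\<mu> \<equiv> s * enorm y powr (p - 2)"
  shows "\<mu> / 2 * (enorm (x - y))\<^sup>2 \<le> reg_quadratic A b s p x - reg_quadratic A b s p y"
    and "\<mu> / 2 * enorm (x - y) \<le> enorm (reg_gradient A b s p x)"
proof -
  show gap: "\<mu> / 2 * (enorm (x - y))\<^sup>2 \<le> reg_quadratic A b s p x - reg_quadratic A b s p y"
    using reg_quadratic_lower_bound[OF A b p s y x] x y by (simp add: stat \<mu>_def enorm_square)
  let ?g = "reg_gradient A b s p x"
  have Ac: "A \<in> carrier_mat d d" using A by (simp add: pos_semidef_def)
  have g: "?g \<in> carrier_vec d" using reg_gradient_carrier[OF Ac b x] .
  have yx: "enorm (y - x) = enorm (x - y)"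
  proof -
    have "y - x = (-1) \<cdot>\<^sub>v (x - y)" using x y by auto
    then show ?thesis by (simp add: enorm_smult)
  qed
  have "0 \<le> s * enorm x powr (p - 2) / 2 * ((y - x) \<bullet> (y - x))"
    using s by (simp add: scalar_prod_self_nonneg)
  then have "- (?g \<bullet> (y - x)) \<ge> \<mu> / 2 * (enorm (x - y))\<^sup>2"
    using reg_quadratic_lower_bound[OF A b p s x y] gap by linarith
  moreover have "\<bar>?g \<bullet> (y - x)\<bar> \<le> enorm ?g * enorm (x - y)"
    using scalar_prod_Cauchy_Schwarz[OF g, of "y - x"] x y yx by simp
  ultimately have le: "\<mu> / 2 * enorm (x - y) * enorm (x - y) \<le> enorm ?g * enorm (x - y)"
    by (simp add: power2_eq_square)
  show "\<mu> / 2 * enorm (x - y) \<le> enorm ?g"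
  proof (cases "enorm (x - y) = 0")
    case True
    then show ?thesis by (simp add: enorm_nonneg)
  next
    case False
    then have "enorm (x - y) > 0" using enorm_nonneg[of "x - y"] by simp
    then show ?thesis using le by simp
  qed
qed

text \<open>This translates the two target rates into \<mu> times \<open>R\<close> squared and \<mu>
  times \<open>R\<close>. After taking logarithms each identity is linear in \<open>ln \<mu>\<close>
  and \<open>ln s\<close>.\<close>

lemma regularized_scale:
  fixes s \<mu> p :: real
  assumes s: "s > 0" and \<mu>: "\<mu> > 0" and p: "p > 2"
  defines "R \<equiv> (\<mu> / s) powr (1 / (p - 2))"
  shows "R > 0" "s * R powr (p - 2) = \<mu>"
    "(\<mu> / s powr (2 / p)) powr (p / (p - 2)) = \<mu> * R\<^sup>2"
    "(\<mu> / s powr (1 / (p - 1))) powr ((p - 1) / (p - 2)) = \<mu> * R"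
proof -
  define \<alpha> where "\<alpha> = ln \<mu>"
  define \<beta> where "\<beta> = ln s"
  have e: "\<mu> = exp \<alpha>" "s = exp \<beta>" using s \<mu> by (auto simp: \<alpha>_def \<beta>_def)
  have R: "R = exp ((\<alpha> - \<beta>) / (p - 2))"
    by (simp add: R_def e powr_def exp_diff[symmetric])
  show "R > 0" by (simp add: R)
  show "s * R powr (p - 2) = \<mu>"
    using p unfolding R e by (simp add: powr_def exp_add[symmetric])
  have "(p / (p - 2)) * (\<alpha> - 2 / p * \<beta>) = \<alpha> + 2 * ((\<alpha> - \<beta>) / (p - 2))"
    using p by (simp add: field_simps)
  then show "(\<mu> / s powr (2 / p)) powr (p / (p - 2)) = \<mu> * R\<^sup>2"
    unfolding R e by (simp add: powr_def exp_diff[symmetric] exp_add[symmetric] exp_double[symmetric])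
  have "((p - 1) / (p - 2)) * (\<alpha> - 1 / (p - 1) * \<beta>) = \<alpha> + (\<alpha> - \<beta>) / (p - 2)"
  proof -
    have "(p - 1) * (\<alpha> - 1 / (p - 1) * \<beta>) = (p - 2) * \<alpha> + (\<alpha> - \<beta>)"
      using p by (simp add: right_diff_distrib) (simp add: algebra_simps)
    then show ?thesis using p by (simp add: add_divide_distrib)
  qed
  then show "(\<mu> / s powr (1 / (p - 1))) powr ((p - 1) / (p - 2)) = \<mu> * R"
    unfolding R e by (simp add: powr_def exp_diff[symmetric] exp_add[symmetric])
qed

section \<open>The chain matrix\<close>

text \<open>This is the sum of the rank-one matrices of each \<open>W i\<close> times its transpose
  (the frame operator), not the table of inner products.\<close>

definition gram_mat :: "nat \<Rightarrow> nat \<Rightarrow> (nat \<Rightarrow> real vec) \<Rightarrow> real mat" where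
  "gram_mat d n W = mat d d (\<lambda>(k, l). \<Sum>i<n. W i $ k * W i $ l)"

lemma gram_mat_carrier [simp]: "gram_mat d n W \<in> carrier_mat d d"
  by (simp add: gram_mat_def)

text \<open>The chain matrix is handled through this bilinear form, so that most later arguments
  avoid matrix entries.\<close>

lemma gram_mat_scalar_prod:
  assumes "x \<in> carrier_vec d" "y \<in> carrier_vec d" "\<And>i. i < n \<Longrightarrow> W i \<in> carrier_vec d"
  shows "y \<bullet> (gram_mat d n W *\<^sub>v x) = (\<Sum>i<n. (W i \<bullet> y) * (W i \<bullet> x))"
proof -
  have "gram_mat d n W *\<^sub>v x = lin_sum d n (\<lambda>i. W i \<bullet> x) W"
  proof (rule eq_vecI)
    fix k assume "k < dim_vec (lin_sum d n (\<lambda>i. W i \<bullet> x) W)"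
    then have k: "k < d" by (simp add: lin_sum_def)
    have "(gram_mat d n W *\<^sub>v x) $ k = (\<Sum>l\<in>{0..<d}. \<Sum>i<n. W i $ k * W i $ l * x $ l)"
      using k assms(1) by (simp add: gram_mat_def scalar_prod_def sum_distrib_right)
    also have "\<dots> = (\<Sum>i<n. \<Sum>l\<in>{0..<d}. W i $ k * W i $ l * x $ l)"
      by (rule sum.swap)
    also have "\<dots> = lin_sum d n (\<lambda>i. W i \<bullet> x) W $ k"
      using k assms(1) by (simp add: lin_sum_def scalar_prod_def sum_distrib_left mult_ac)
    finally show "(gram_mat d n W *\<^sub>v x) $ k = lin_sum d n (\<lambda>i. W i \<bullet> x) W $ k" .
  qed (simp add: gram_mat_def lin_sum_def)
  then show ?thesis
    using assms by (simp add: scalar_prod_lin_sum mult.commute)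
qed

lemma smult_mat_mult_vec:
  assumes "x \<in> carrier_vec (dim_col A)"
  shows "(c \<cdot>\<^sub>m A) *\<^sub>v x = c \<cdot>\<^sub>v (A *\<^sub>v (x :: real vec))"
  by (rule eq_vecI) (use assms in \<open>auto simp: scalar_prod_def sum_distrib_left mult.assoc\<close>)

text \<open>The chain is a path with conductances \<open>L / 4\<close> and masses \<open>m\<^sub>i\<close>, where
  \<open>chain_weight N i = m\<^sub>i\<^bsup>-1/2\<^esup>\<close>. The masses are those for which the potential \<open>(N / (N + 5))\<^sup>i\<close> solves
  \<open>(A + L / N\<^sup>2) z = \<beta> v\<^sub>0\<close>; the 5 makes all of them at least 1, as \<open>A \<le> L\<close> requires.\<close>

definition chain_weight :: "nat \<Rightarrow> nat \<Rightarrow> real" where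
  "chain_weight N i = (if i < N then sqrt (4 * (real N + 5) / (25 * real N)) else sqrt (4 / (5 * real N)))"

text \<open>Call \<open>chain_weight N i * (V i \<bullet> x)\<close> the potential of
  \<open>x\<close> at node \<open>i\<close>. Pairing a link with \<open>x\<close> gives the
  potential drop along that edge.\<close>

definition chain_link :: "nat \<Rightarrow> (nat \<Rightarrow> real vec) \<Rightarrow> nat \<Rightarrow> real vec" where
  "chain_link N V j = chain_weight N j \<cdot>\<^sub>v V j - chain_weight N (Suc j) \<cdot>\<^sub>v V (Suc j)"

text \<open>For orthonormal \<open>V\<close> the first two terms amount to \<open>L\<close> times
  the projection onto the orthogonal complement of the span; the last is the energy of the
  chain.\<close>

definition chain_mat :: "nat \<Rightarrow> nat \<Rightarrow> real \<Rightarrow> (nat \<Rightarrow> real vec) \<Rightarrow> real mat" where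
  "chain_mat d N L V = (L \<cdot>\<^sub>m 1\<^sub>m d + (- L) \<cdot>\<^sub>m gram_mat d (Suc N) V)
     + (L / 4) \<cdot>\<^sub>m gram_mat d N (chain_link N V)"

lemma chain_mat_carrier [simp]: "chain_mat d N L V \<in> carrier_mat d d"
  by (simp add: chain_mat_def)

lemma chain_weight_bounds:
  assumes "N \<ge> 1"
  shows "chain_weight N i > 0" "chain_weight N i \<le> 1"
    "i < N \<Longrightarrow> (chain_weight N i)\<^sup>2 = 4 * (real N + 5) / (25 * real N)"
    "(chain_weight N N)\<^sup>2 = 4 / (5 * real N)"
  using assms by (auto simp: chain_weight_def divide_simps)

lemma chain_link_carrier:
  "orthonormal d (Suc N) V \<Longrightarrow> j < N \<Longrightarrow> chain_link N V j \<in> carrier_vec d"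
  by (simp add: chain_link_def orthonormal_carrier)

lemma chain_link_scalar_prod:
  assumes "orthonormal d (Suc N) V" "j < N" "x \<in> carrier_vec d"
  shows "chain_link N V j \<bullet> x = chain_weight N j * (V j \<bullet> x) - chain_weight N (Suc j) * (V (Suc j) \<bullet> x)"
  using assms orthonormal_carrier[OF assms(1), of j] orthonormal_carrier[OF assms(1), of "Suc j"]
  by (simp add: chain_link_def minus_scalar_prod_distrib[of _ d])

lemma chain_mat_scalar_prod:
  assumes V: "orthonormal d (Suc N) V" and x: "x \<in> carrier_vec d" and y: "y \<in> carrier_vec d"
  shows "y \<bullet> (chain_mat d N L V *\<^sub>v x) = L * (y \<bullet> x) - L * (\<Sum>i<Suc N. (V i \<bullet> y) * (V i \<bullet> x))
    + L / 4 * (\<Sum>j<N. (chain_link N V j \<bullet> y) * (chain_link N V j \<bullet> x))"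
proof -
  have "chain_mat d N L V *\<^sub>v x = (L \<cdot>\<^sub>v x + (- L) \<cdot>\<^sub>v (gram_mat d (Suc N) V *\<^sub>v x))
      + (L / 4) \<cdot>\<^sub>v (gram_mat d N (chain_link N V) *\<^sub>v x)"
    using x unfolding chain_mat_def
    by (simp add: add_mult_distrib_mat_vec[of _ d d] smult_mat_mult_vec gram_mat_def[of d])
  moreover have "gram_mat d n W *\<^sub>v x \<in> carrier_vec d" for n W
    using x gram_mat_carrier by (metis mult_mat_vec_carrier)
  ultimately have "y \<bullet> (chain_mat d N L V *\<^sub>v x) = L * (y \<bullet> x)
      - L * (y \<bullet> (gram_mat d (Suc N) V *\<^sub>v x)) + L / 4 * (y \<bullet> (gram_mat d N (chain_link N V) *\<^sub>v x))"
    using x y by (simp add: scalar_prod_add_distrib[of _ d])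
  then show ?thesis
    using x y V by (simp only: gram_mat_scalar_prod orthonormal_carrier chain_link_carrier)
qed

text \<open>Weights are at most 1, a squared difference is at most twice the sum of squares, and a
  node lies on at most two edges. The resulting factor 4 cancels the conductance
  \<open>L / 4\<close>.\<close>

lemma chain_mat_quadratic_le:
  assumes V: "orthonormal d (Suc N) V" and N: "N \<ge> 1" and L: "L \<ge> 0" and x: "x \<in> carrier_vec d"
  shows "x \<bullet> (chain_mat d N L V *\<^sub>v x) \<le> L * (x \<bullet> x)"
proof -
  let ?q = "\<lambda>i. (V i \<bullet> x)\<^sup>2"
  have weighted: "(chain_weight N i * (V i \<bullet> x))\<^sup>2 \<le> ?q i" for i
  proof -
    have "(chain_weight N i)\<^sup>2 \<le> 1"
      using chain_weight_bounds(1,2)[OF N, of i] by (simp add: power_le_one)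
    then show ?thesis unfolding power_mult_distrib by (simp add: mult_left_le_one_le)
  qed
  have "(chain_link N V j \<bullet> x)\<^sup>2 \<le> 2 * ?q j + 2 * ?q (Suc j)" if "j < N" for j
  proof -
    have "(a - c)\<^sup>2 \<le> 2 * a\<^sup>2 + 2 * c\<^sup>2" for a c :: real
      using zero_le_power2[of "a + c"] by (simp add: power2_sum power2_diff)
    then show ?thesis
      unfolding chain_link_scalar_prod[OF V that x]
      by (rule order_trans) (use weighted[of j] weighted[of "Suc j"] in linarith)
  qed
  then have "(\<Sum>j<N. (chain_link N V j \<bullet> x)\<^sup>2) \<le> (\<Sum>j<N. 2 * ?q j + 2 * ?q (Suc j))"
    by (intro sum_mono) auto
  also have "\<dots> = 2 * (\<Sum>j<N. ?q j) + 2 * (\<Sum>j<N. ?q (Suc j))"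
    by (simp add: sum.distrib sum_distrib_left)
  also have "\<dots> \<le> 4 * (\<Sum>i<Suc N. ?q i)"
  proof -
    have "(\<Sum>j<N. ?q j) \<le> (\<Sum>i<Suc N. ?q i)" by simp
    moreover have "(\<Sum>j<N. ?q (Suc j)) \<le> (\<Sum>i<Suc N. ?q i)"
      by (subst sum.lessThan_Suc_shift) simp
    ultimately show ?thesis by linarith
  qed
  finally have "L / 4 * (\<Sum>j<N. (chain_link N V j \<bullet> x)\<^sup>2) \<le> L / 4 * (4 * (\<Sum>i<Suc N. ?q i))"
    using L by (intro mult_left_mono) auto
  then show ?thesis
    unfolding chain_mat_scalar_prod[OF V x x] by (simp add: power2_eq_square algebra_simps)
qed

lemma pos_semidef_chain_mat:
  assumes V: "orthonormal d (Suc N) V" and L: "L \<ge> 0"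
  shows "pos_semidef d (chain_mat d N L V)"
  unfolding pos_semidef_def
proof (intro conjI ballI)
  show "transpose_mat (chain_mat d N L V) = chain_mat d N L V"
    unfolding chain_mat_def
    by (rule eq_matI) (auto simp: gram_mat_def mult.commute)
  fix x :: "real vec" assume x: "x \<in> carrier_vec d"
  have "0 \<le> L * (x \<bullet> x - (\<Sum>i<Suc N. (V i \<bullet> x)\<^sup>2))"
    using Bessel_inequality[OF V x] L by (intro mult_nonneg_nonneg) simp_all
  moreover have "0 \<le> L / 4 * (\<Sum>j<N. (chain_link N V j \<bullet> x)\<^sup>2)"
    using L by (simp add: sum_nonneg)
  ultimately show "0 \<le> x \<bullet> (chain_mat d N L V *\<^sub>v x)"
    unfolding chain_mat_scalar_prod[OF V x x] by (simp add: power2_eq_square right_diff_distrib)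
qed simp

text \<open>\<open>w\<close> puts \<open>L\<close> into the spectrum, and testing the form on any
  eigenvector bounds its eigenvalue by \<open>L\<close>.\<close>

lemma lambda_max_eqI:
  assumes A: "A \<in> carrier_mat d d"
    and w: "w \<in> carrier_vec d" "w \<noteq> 0\<^sub>v d" "A *\<^sub>v w = L \<cdot>\<^sub>v w"
    and le: "\<And>x. x \<in> carrier_vec d \<Longrightarrow> x \<bullet> (A *\<^sub>v x) \<le> L * (x \<bullet> x)"
  shows "lambda_max A = L"
  unfolding lambda_max_def
proof (rule Max_eqI)
  show "finite (spectrum A)" using A by (rule card_finite_spectrum)
  show "L \<in> spectrum A"
    using A w by (auto simp: spectrum_def eigenvalue_def eigenvector_def)
  fix l assume "l \<in> spectrum A"
  then obtain x where x: "x \<in> carrier_vec d" "x \<noteq> 0\<^sub>v d" "A *\<^sub>v x = l \<cdot>\<^sub>v x"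
    using A by (auto simp: spectrum_def eigenvalue_def eigenvector_def)
  have "x \<bullet> x > 0"
    using scalar_prod_self_nonneg[of x] scalar_prod_self_eq_0[OF x(1)] x(2) by force
  moreover have "l * (x \<bullet> x) \<le> L * (x \<bullet> x)" using le[OF x(1)] x by simp
  ultimately show "l \<le> L" by simp
qed

text \<open>Since \<open>Suc N < d\<close>, some unit vector is orthogonal to the whole chain, and
  it is an eigenvector for \<open>L\<close>.\<close>

lemma lambda_max_chain_mat:
  assumes V: "orthonormal d (Suc N) V" and N: "N \<ge> 1" and d: "Suc N < d" and L: "L \<ge> 0"
  shows "lambda_max (chain_mat d N L V) = L"
proof -
  have "set (map V [0..<Suc N]) \<subseteq> carrier_vec d" using orthonormal_carrier[OF V] by auto
  moreover have "length (map V [0..<Suc N]) < d" using d by simp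
  ultimately obtain w where w: "w \<in> carrier_vec d" "w \<bullet> w = 1"
      and "\<forall>v \<in> set (map V [0..<Suc N]). v \<bullet> w = 0"
    using exists_unit_orthogonal by blast
  then have Vw: "V i \<bullet> w = 0" if "i < Suc N" for i using that by (simp del: upt_Suc)
  have "w \<noteq> 0\<^sub>v d" using w by auto
  moreover have "chain_mat d N L V *\<^sub>v w = L \<cdot>\<^sub>v w"
  proof (rule vec_eq_by_scalar_prod[of _ d])
    fix y :: "real vec" assume y: "y \<in> carrier_vec d"
    show "y \<bullet> (chain_mat d N L V *\<^sub>v w) = y \<bullet> (L \<cdot>\<^sub>v w)"
      using y w by (simp add: chain_mat_scalar_prod[OF V] chain_link_scalar_prod[OF V] Vw)
  qed (use w mult_mat_vec_carrier[OF chain_mat_carrier] in auto)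
  ultimately show ?thesis
    using w chain_mat_quadratic_le[OF V N L] by (intro lambda_max_eqI[of _ d w]) auto
qed

text \<open>Multiplication by the matrix spreads information by one node: although \<open>x\<close>
  has no component along \<open>V k\<close>, the edge from \<open>k - 1\<close> to \<open>k\<close>
  brings \<open>V k\<close> into the product. Hence the families must agree up to and including
  \<open>k\<close>.\<close>

lemma chain_mat_local:
  assumes V: "orthonormal d (Suc N) V" and V': "orthonormal d (Suc N) V'"
    and x: "x \<in> carrier_vec d" and eq: "\<And>i. i \<le> k \<Longrightarrow> V i = V' i"
    and orth: "\<And>i. k \<le> i \<Longrightarrow> i \<le> N \<Longrightarrow> V i \<bullet> x = 0" "\<And>i. k \<le> i \<Longrightarrow> i \<le> N \<Longrightarrow> V' i \<bullet> x = 0"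
  shows "chain_mat d N L V *\<^sub>v x = chain_mat d N L V' *\<^sub>v x"
proof (rule vec_eq_by_scalar_prod[of _ d])
  fix y :: "real vec" assume y: "y \<in> carrier_vec d"
  have "(V i \<bullet> y) * (V i \<bullet> x) = (V' i \<bullet> y) * (V' i \<bullet> x)" if "i < Suc N" for i
    using eq[of i] orth[of i] that by (cases "i \<le> k") auto
  then have "(\<Sum>i<Suc N. (V i \<bullet> y) * (V i \<bullet> x)) = (\<Sum>i<Suc N. (V' i \<bullet> y) * (V' i \<bullet> x))"
    by (intro sum.cong) auto
  moreover have "(chain_link N V j \<bullet> y) * (chain_link N V j \<bullet> x)
      = (chain_link N V' j \<bullet> y) * (chain_link N V' j \<bullet> x)" if "j < N" for j
  \<comment> \<open>Either both ends of the edge are common to the two families, or both ends are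
    orthogonal to \<open>x\<close> and the edge contributes nothing.\<close>
  proof (cases "Suc j \<le> k")
    case True
    then show ?thesis by (simp add: chain_link_def eq)
  next
    case False
    then show ?thesis using orth[of j] orth[of "Suc j"] that x
      by (simp add: chain_link_scalar_prod[OF V] chain_link_scalar_prod[OF V'])
  qed
  then have "(\<Sum>j<N. (chain_link N V j \<bullet> y) * (chain_link N V j \<bullet> x))
      = (\<Sum>j<N. (chain_link N V' j \<bullet> y) * (chain_link N V' j \<bullet> x))"
    by (intro sum.cong) auto
  ultimately show "y \<bullet> (chain_mat d N L V *\<^sub>v x) = y \<bullet> (chain_mat d N L V' *\<^sub>v x)"
    unfolding chain_mat_scalar_prod[OF V x y] chain_mat_scalar_prod[OF V' x y] by simp
qed (use x mult_mat_vec_carrier[OF chain_mat_carrier] in auto)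

section \<open>The explicit stationary point\<close>

text \<open>These are the coordinates along \<open>V\<close> of the vector with geometric potential;
  dividing by the weight turns a potential into a coordinate.\<close>

definition chain_coeff :: "nat \<Rightarrow> nat \<Rightarrow> real" where
  "chain_coeff N i = (real N / (real N + 5)) ^ i / chain_weight N i"

text \<open>The coefficients of \<open>e i\<close> cancel at every node except 0. In weak form, the
  geometric potential balances edge currents against masses with a source at the first node
  only.\<close>

lemma geometric_summation_by_parts:
  fixes e :: "nat \<Rightarrow> real"
  shows "r * (\<Sum>j<n. (e j - e (Suc j)) * r ^ j) + (1 - r) * (\<Sum>i<n. r ^ i * e i) + r ^ n * e n = e 0"
proof (induction n)
  case (Suc n)
  have "r * (\<Sum>j<Suc n. (e j - e (Suc j)) * r ^ j) + (1 - r) * (\<Sum>i<Suc n. r ^ i * e i) + r ^ Suc n * e (Suc n)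
    = r * (\<Sum>j<n. (e j - e (Suc j)) * r ^ j) + (1 - r) * (\<Sum>i<n. r ^ i * e i) + r ^ n * e n"
    by (simp add: algebra_simps)
  then show ?case using Suc by simp
qed simp

text \<open>The linear system is tested against an arbitrary \<open>y\<close>. The masses are tuned
  so that edge and mass terms share the factor \<open>c\<close> and summation by parts
  applies.\<close>

lemma chain_solution:
  assumes V: "orthonormal d (Suc N) V" and N: "N \<ge> 1" and y: "y \<in> carrier_vec d"
  defines "z \<equiv> lin_sum d (Suc N) (chain_coeff N) V"
  shows "y \<bullet> (chain_mat d N L V *\<^sub>v z) + L / (real N)\<^sup>2 * (y \<bullet> z)
    = 5 * L / (4 * real N) * chain_weight N 0 * (V 0 \<bullet> y)"
proof -
  define r where "r = real N / (real N + 5)"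
  define c where "c = 5 * L / (4 * real N)"
  define e where "e i = chain_weight N i * (V i \<bullet> y)" for i
  have z: "z \<in> carrier_vec d" by (simp add: z_def)
  have Vz: "V i \<bullet> z = chain_coeff N i" if "i < Suc N" for i
    unfolding z_def using V that by (rule orthonormal_coordinate)
  have wz: "chain_weight N i * chain_coeff N i = r ^ i" for i
    using chain_weight_bounds(1)[OF N, of i] by (simp add: chain_coeff_def r_def)
  have yz: "y \<bullet> z = (\<Sum>i<Suc N. (V i \<bullet> y) * (V i \<bullet> z))"
    using V y Vz unfolding z_def
    by (subst scalar_prod_lin_sum) (auto simp: orthonormal_carrier mult.commute)
  have coeff: "L / (real N)\<^sup>2 * ((V i \<bullet> y) * (V i \<bullet> z))
      = L / (real N)\<^sup>2 / (chain_weight N i)\<^sup>2 * (r ^ i * e i)" if "i < Suc N" for i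
    using chain_weight_bounds(1)[OF N, of i] that
    by (simp add: Vz chain_coeff_def r_def e_def power2_eq_square field_simps)
  have m: "L / (real N)\<^sup>2 / (chain_weight N i)\<^sup>2 = c * (1 - r)" if "i < N" for i
    unfolding chain_weight_bounds(3)[OF N that] using N by (simp add: c_def r_def field_simps power2_eq_square)
  \<comment> \<open>The last node has no factor \<open>1 - r\<close>: its mass replaces the whole
    geometric tail of an infinite chain.\<close>
  have mN: "L / (real N)\<^sup>2 / (chain_weight N N)\<^sup>2 = c"
    unfolding chain_weight_bounds(4)[OF N] using N by (simp add: c_def field_simps power2_eq_square)
  have "L / (real N)\<^sup>2 * (y \<bullet> z) = (\<Sum>i<Suc N. L / (real N)\<^sup>2 * ((V i \<bullet> y) * (V i \<bullet> z)))"
    by (simp only: yz sum_distrib_left)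
  also have "\<dots> = (\<Sum>i<N. c * (1 - r) * (r ^ i * e i)) + c * (r ^ N * e N)"
  proof -
    have "L / (real N)\<^sup>2 * ((V i \<bullet> y) * (V i \<bullet> z)) = c * (1 - r) * (r ^ i * e i)" if "i < N" for i
      using that by (simp only: coeff m less_SucI)
    moreover have "L / (real N)\<^sup>2 * ((V N \<bullet> y) * (V N \<bullet> z)) = c * (r ^ N * e N)"
      by (simp only: coeff mN lessI)
    ultimately show ?thesis by (simp only: sum.lessThan_Suc cong: sum.cong_simp) simp
  qed
  also have "\<dots> = c * ((1 - r) * (\<Sum>i<N. r ^ i * e i) + r ^ N * e N)"
    by (simp add: sum_distrib_left algebra_simps)
  finally have mass: "L / (real N)\<^sup>2 * (y \<bullet> z) = c * ((1 - r) * (\<Sum>i<N. r ^ i * e i) + r ^ N * e N)" .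
  have lc: "L / 4 * (1 - r) = c * r"
  proof -
    have "1 - r = 5 / (real N + 5)" by (simp add: r_def field_simps)
    then show ?thesis using N by (simp add: c_def r_def)
  qed
  have links: "(chain_link N V j \<bullet> y) * (chain_link N V j \<bullet> z) = (1 - r) * ((e j - e (Suc j)) * r ^ j)"
    if "j < N" for j
  proof -
    have "chain_link N V j \<bullet> y = e j - e (Suc j)"
      by (simp add: chain_link_scalar_prod[OF V that y] e_def)
    moreover have "chain_link N V j \<bullet> z = r ^ j - r ^ Suc j"
      unfolding chain_link_scalar_prod[OF V that z] wz[symmetric] using that by (simp add: Vz)
    then have "chain_link N V j \<bullet> z = (1 - r) * r ^ j" by (simp add: algebra_simps)
    ultimately show ?thesis by simp
  qed
  have "L / 4 * (\<Sum>j<N. (chain_link N V j \<bullet> y) * (chain_link N V j \<bullet> z))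
      = L / 4 * (\<Sum>j<N. (1 - r) * ((e j - e (Suc j)) * r ^ j))"
    using links by simp
  also have "\<dots> = L / 4 * (1 - r) * (\<Sum>j<N. (e j - e (Suc j)) * r ^ j)"
    by (simp only: sum_distrib_left mult.assoc)
  finally have "y \<bullet> (chain_mat d N L V *\<^sub>v z) = c * r * (\<Sum>j<N. (e j - e (Suc j)) * r ^ j)"
    unfolding chain_mat_scalar_prod[OF V z y] yz lc by simp
  then have "y \<bullet> (chain_mat d N L V *\<^sub>v z) + L / (real N)\<^sup>2 * (y \<bullet> z)
    = c * (r * (\<Sum>j<N. (e j - e (Suc j)) * r ^ j) + (1 - r) * (\<Sum>i<N. r ^ i * e i) + r ^ N * e N)"
    unfolding mass by (simp add: algebra_simps)
  also have "\<dots> = c * e 0" unfolding geometric_summation_by_parts ..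
  finally show ?thesis by (simp add: c_def e_def mult.assoc)
qed

text \<open>Each of the first \<open>N\<close> squared coordinates is at most 25/4, while the last
  one is \<open>5 * N / 4\<close> times \<open>r ^ N\<close> squared, with \<open>r ^ N\<close> at
  least \<open>exp (-5)\<close>. Both sides grow like \<open>N\<close>, so the ratio is bounded by
  an absolute constant.\<close>

lemma chain_tail_mass:
  assumes N: "N \<ge> 1"
  shows "(\<Sum>i<Suc N. (chain_coeff N i)\<^sup>2) \<le> (1 + 5 * exp 10) * (chain_coeff N N)\<^sup>2"
proof -
  define r where "r = real N / (real N + 5)"
  have r: "0 < r" "r \<le> 1" using N by (auto simp: r_def)
  have "(chain_coeff N i)\<^sup>2 \<le> 25 / 4" if "i < N" for i
  proof -
    have "(chain_coeff N i)\<^sup>2 = (r ^ i)\<^sup>2 * (25 * real N / (4 * (real N + 5)))"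
      using N that by (simp add: chain_coeff_def r_def[symmetric] power_divide chain_weight_bounds)
    also have "\<dots> \<le> 1 * (25 / 4)"
      using r N by (intro mult_mono) (auto simp: power_le_one field_simps)
    finally show ?thesis by simp
  qed
  then have "(\<Sum>i<N. (chain_coeff N i)\<^sup>2) \<le> (\<Sum>i<N. 25 / 4)" by (intro sum_mono) auto
  then have bulk: "(\<Sum>i<N. (chain_coeff N i)\<^sup>2) \<le> 25 / 4 * real N" by (simp add: mult.commute)
  have "(1 / r) ^ N = (1 + 5 / real N) ^ N" using N by (simp add: r_def field_simps)
  also have "\<dots> \<le> exp 5" using N by (intro exp_ge_one_plus_x_over_n_power_n) auto
  finally have "1 \<le> exp 5 * r ^ N" using r by (simp add: power_one_over field_simps)
  then have "1\<^sup>2 \<le> (exp 5 * r ^ N)\<^sup>2" by (intro power_mono) auto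
  also have "\<dots> = exp 10 * (r ^ N)\<^sup>2" by (simp add: power_mult_distrib exp_double[symmetric])
  finally have "25 / 4 * real N * 1 \<le> 25 / 4 * real N * (exp 10 * (r ^ N)\<^sup>2)"
    by (intro mult_left_mono) auto
  also have "\<dots> = 5 * exp 10 * (chain_coeff N N)\<^sup>2"
    using N by (simp add: chain_coeff_def r_def[symmetric] power_divide chain_weight_bounds)
  finally show ?thesis using bulk by (simp add: algebra_simps)
qed

text \<open>The prescribed norm freezes the coefficient of the regularizer's gradient at
  \<open>L / (real N)\<^sup>2\<close>, so the nonlinear stationarity condition becomes the linear
  system of \<open>chain_solution\<close>, scaled by \<tau>.\<close>

lemma chain_stationary:
  assumes V: "orthonormal d (Suc N) V" and N: "N \<ge> 1" and \<tau>: "\<tau> \<ge> 0"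
    and \<mu>: "s * (\<tau> * enorm (lin_sum d (Suc N) (chain_coeff N) V)) powr (p - 2) = L / (real N)\<^sup>2"
  defines "y \<equiv> \<tau> \<cdot>\<^sub>v lin_sum d (Suc N) (chain_coeff N) V"
  shows "reg_gradient (chain_mat d N L V) ((\<tau> * (5 * L / (4 * real N) * chain_weight N 0)) \<cdot>\<^sub>v V 0) s p y = 0\<^sub>v d"
proof (rule vec_eq_by_scalar_prod[of _ d])
  let ?z = "lin_sum d (Suc N) (chain_coeff N) V" and ?A = "chain_mat d N L V"
  let ?b = "(\<tau> * (5 * L / (4 * real N) * chain_weight N 0)) \<cdot>\<^sub>v V 0"
  have V0: "V 0 \<in> carrier_vec d" using V by (simp add: orthonormal_carrier)
  have y: "y \<in> carrier_vec d" by (simp add: y_def)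
  show "reg_gradient ?A ?b s p y \<in> carrier_vec d"
    using y V0 by (intro reg_gradient_carrier) auto
  fix u :: "real vec" assume u: "u \<in> carrier_vec d"
  have Ay: "?A *\<^sub>v y = \<tau> \<cdot>\<^sub>v (?A *\<^sub>v ?z)"
    unfolding y_def by (rule mult_mat_vec[OF chain_mat_carrier]) simp
  have Az: "?A *\<^sub>v ?z \<in> carrier_vec d" by (rule mult_mat_vec_carrier[OF chain_mat_carrier]) simp
  have "s * enorm y powr (p - 2) = L / (real N)\<^sup>2"
    using \<mu> \<tau> by (simp add: y_def enorm_smult)
  then have "u \<bullet> reg_gradient ?A ?b s p y
      = \<tau> * (u \<bullet> (?A *\<^sub>v ?z)) - u \<bullet> ?b + L / (real N)\<^sup>2 * (u \<bullet> y)"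
    using u y V0 Az
    by (simp add: reg_gradient_def Ay scalar_prod_add_distrib[of _ d] scalar_prod_minus_distrib[of _ d])
  also have "u \<bullet> y = \<tau> * (u \<bullet> ?z)" using u by (simp add: y_def)
  also have "u \<bullet> ?b = \<tau> * (5 * L / (4 * real N) * chain_weight N 0 * (V 0 \<bullet> u))"
    using u V0 comm_scalar_prod[OF u V0] by (simp add: mult.assoc)
  also have "\<dots> = \<tau> * (u \<bullet> (?A *\<^sub>v ?z) + L / (real N)\<^sup>2 * (u \<bullet> ?z))"
    using chain_solution[OF V N u, of L] by simp
  finally show "u \<bullet> reg_gradient ?A ?b s p y = u \<bullet> 0\<^sub>v d" using u by (simp add: algebra_simps)
qed simp

section \<open>The resisting oracle\<close>

text \<open>Induction on the number of iterates already fixed: stage \<open>k\<close> makes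
  \<open>V i\<close> orthogonal to iterate \<open>j\<close> whenever \<open>j \<le> k\<close> and
  \<open>j \<le> i\<close>. The next stage keeps \<open>V 0\<close> to \<open>V k\<close> and
  replaces the rest; by \<open>local\<close> the answers at iterates 0 to \<open>k\<close> do not
  change.\<close>

lemma resisting_basis:
  fixes F :: "(nat \<Rightarrow> real vec) \<Rightarrow> real vec \<Rightarrow> real"
  assumes M: "first_order_method d M" and d: "2 * N + 1 \<le> d"
    and grad: "\<And>V x. orthonormal d (Suc N) V \<Longrightarrow> x \<in> carrier_vec d \<Longrightarrow> gradient d (F V) x \<in> carrier_vec d"
    and local: "\<And>V V' k x. orthonormal d (Suc N) V \<Longrightarrow> orthonormal d (Suc N) V' \<Longrightarrow>
      x \<in> carrier_vec d \<Longrightarrow> (\<And>i. i \<le> k \<Longrightarrow> V i = V' i) \<Longrightarrow>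
      (\<And>i. k \<le> i \<Longrightarrow> i \<le> N \<Longrightarrow> V i \<bullet> x = 0) \<Longrightarrow> (\<And>i. k \<le> i \<Longrightarrow> i \<le> N \<Longrightarrow> V' i \<bullet> x = 0) \<Longrightarrow>
      fo_info d (F V) x = fo_info d (F V') x"
  shows "\<exists>V. orthonormal d (Suc N) V \<and> iterate d M (F V) N \<in> carrier_vec d
    \<and> V N \<bullet> iterate d M (F V) N = 0"
proof -
  have iter: "iterate d M (F V) k \<in> carrier_vec d" if V: "orthonormal d (Suc N) V" for V k
  proof (induction k rule: less_induct)
    case (less k)
    show ?case
    proof (cases k)
      case (Suc m)
      let ?hs = "map (\<lambda>i. fo_info d (F V) (iterate d M (F V) i)) [0..<Suc m]"
      have "snd ` set ?hs \<subseteq> carrier_vec d"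
        using less Suc grad[OF V] by (auto simp: fo_info_def less_Suc_eq)
      moreover have "length ?hs = Suc m" by simp
      ultimately have "M m ?hs \<in> carrier_vec d" using M unfolding first_order_method_def by blast
      then show ?thesis by (simp add: Suc del: upt_Suc)
    qed simp
  qed
  have "\<exists>V. orthonormal d (Suc N) V \<and>
      (\<forall>j\<le>k. \<forall>i. j \<le> i \<longrightarrow> i \<le> N \<longrightarrow> V i \<bullet> iterate d M (F V) j = 0)" if "k \<le> N" for k
    using that
  proof (induction k)
    case 0
    obtain V where "orthonormal d (Suc N) V"
      using exists_orthonormal_orthogonal[of "[]" d "Suc N"] d by auto
    then show ?case by (intro exI[of _ V]) (auto simp: orthonormal_def)
  next
    case (Suc k)
    then obtain V where V: "orthonormal d (Suc N) V"
      and VI: "\<And>j i. j \<le> k \<Longrightarrow> j \<le> i \<Longrightarrow> i \<le> N \<Longrightarrow> V i \<bullet> iterate d M (F V) j = 0"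
      by auto
    \<comment> \<open>Iterate 0 is the zero vector and imposes no condition. Thus \<open>W\<close>
      has \<open>2 * k + 2\<close> vectors, and with the \<open>N - k\<close> new ones the total is
      \<open>N + k + 2\<close>, at most \<open>2 * N + 1\<close> because
      \<open>k < N\<close>.\<close>
    define X where "X = map (iterate d M (F V)) [1..<Suc (Suc k)]"
    define W where "W = map V [0..<Suc k] @ X"
    have "set W \<subseteq> carrier_vec d" using Suc.prems iter[OF V] orthonormal_carrier[OF V]
      by (auto simp: W_def X_def simp del: upt_Suc)
    moreover have "length W + (N - k) \<le> d" using Suc.prems d by (simp add: W_def X_def)
    ultimately obtain E where E: "orthonormal d (N - k) E"
      and EW: "\<And>i w. i < N - k \<Longrightarrow> w \<in> set W \<Longrightarrow> w \<bullet> E i = 0"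
      using exists_orthonormal_orthogonal by blast
    define V' where "V' i = (if i \<le> k then V i else E (i - Suc k))" for i
    have Ec: "E i \<in> carrier_vec d" if "i < N - k" for i using orthonormal_carrier[OF E that] .
    have VE: "V i \<bullet> E j = 0" "E j \<bullet> V i = 0" if "i \<le> k" "j < N - k" for i j
    proof -
      show "V i \<bullet> E j = 0" using EW[of j "V i"] that by (simp add: W_def del: upt_Suc)
      then show "E j \<bullet> V i = 0"
        using comm_scalar_prod[OF Ec[OF that(2)] orthonormal_carrier[OF V, of i]] that by simp
    qed
    have EX: "E i \<bullet> iterate d M (F V) j = 0" if "j \<le> Suc k" "i < N - k" for i j
    proof (cases j)
      case 0
      then show ?thesis using Ec[OF that(2)] by simp
    next
      case Suc
      then have "j \<in> set [1..<Suc (Suc k)]" using that by (simp del: upt_Suc)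
      then have "iterate d M (F V) j \<in> set W" by (auto simp: W_def X_def simp del: upt_Suc)
      then show ?thesis
        using EW[OF that(2)] comm_scalar_prod[OF Ec[OF that(2)] iter[OF V, of j]] by simp
    qed
    have V': "orthonormal d (Suc N) V'"
      unfolding orthonormal_def
    proof (intro conjI allI impI)
      fix i assume i: "i < Suc N"
      show "V' i \<in> carrier_vec d"
        using i Ec[of "i - Suc k"] orthonormal_carrier[OF V i] by (auto simp: V'_def)
      fix j assume j: "j < Suc N"
      have e: "i - Suc k < N - k" if "\<not> i \<le> k" using i that by simp
      have e': "j - Suc k < N - k" if "\<not> j \<le> k" using j that by simp
      show "V' i \<bullet> V' j = (if i = j then 1 else 0)"
        using i j e e' VE V E by (auto simp: V'_def orthonormal_def)
    qed
    have V'I: "V' i \<bullet> iterate d M (F V) j = 0" if "j \<le> k" "j \<le> i" "i \<le> N" for i j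
      using that VI EX by (auto simp: V'_def)
    \<comment> \<open>Iterate \<open>Suc k\<close> is included: it is computed from answers at
      iterates up to \<open>k\<close>, which both families share.\<close>
    have same: "iterate d M (F V') j = iterate d M (F V) j" if "j \<le> Suc k" for j
      using that
    proof (induction j rule: less_induct)
      case (less j)
      show ?case
      proof (cases j)
        case (Suc m)
        have "fo_info d (F V') (iterate d M (F V') i) = fo_info d (F V) (iterate d M (F V) i)"
          if i: "i < Suc m" for i
        proof -
          have "iterate d M (F V') i = iterate d M (F V) i" using less Suc i by simp
          moreover have "fo_info d (F V') (iterate d M (F V) i) = fo_info d (F V) (iterate d M (F V) i)"
            using i Suc less.prems V'I VI
            by (intro local[OF V' V iter[OF V], of i]) (auto simp: V'_def)
          ultimately show ?thesis by simp
        qed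
        then have "map (\<lambda>i. fo_info d (F V') (iterate d M (F V') i)) [0..<Suc m]
            = map (\<lambda>i. fo_info d (F V) (iterate d M (F V) i)) [0..<Suc m]"
          by (intro map_cong) auto
        then show ?thesis by (simp only: Suc iterate.simps)
      qed simp
    qed
    show ?case
    proof (intro exI conjI allI impI)
      show "orthonormal d (Suc N) V'" by (rule V')
      fix j i assume ji: "j \<le> Suc k" "j \<le> i" "i \<le> N"
      show "V' i \<bullet> iterate d M (F V') j = 0"
      proof (cases "j \<le> k")
        case True
        then show ?thesis using V'I ji same by simp
      next
        case False
        then have "V' i = E (i - Suc k)" "i - Suc k < N - k" using ji by (auto simp: V'_def)
        then show ?thesis using EX ji same by simp
      qed
    qed
  qed
  from this[of N] obtain V where V: "orthonormal d (Suc N) V" and "V N \<bullet> iterate d M (F V) N = 0"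
    by auto
  then show ?thesis using iter[OF V] by blast
qed

section \<open>The lower bounds\<close>

lemma gradient_reg_quadratic_chain:
  assumes V: "orthonormal d (Suc N) V" and N: "N \<ge> 1" and L: "L \<ge> 0" and p: "p > 2" and s: "s > 0"
    and b: "b \<in> carrier_vec d" and x: "x \<in> carrier_vec d"
  shows "gradient d (reg_quadratic (chain_mat d N L V) b s p) x
    = reg_gradient (chain_mat d N L V) b s p x"
  by (rule gradient_eq, rule has_gradient_reg_quadratic[OF pos_semidef_chain_mat[OF V L] b p s _ L x])
    (rule chain_mat_quadratic_le[OF V N L])

theorem theorem22:
  shows "\<exists>c::real. c > 0 \<and>
    (\<forall>(p::real) (s::real) (L::real) (d::nat) (N::nat) (M::fo_method).
      p > 2 \<longrightarrow> s > 0 \<longrightarrow> L > 0 \<longrightarrow> 1 \<le> N \<longrightarrow> real N \<le> (real d - 1) / 2 \<longrightarrow>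
      first_order_method d M \<longrightarrow>
      (\<exists>A b. pos_semidef d A \<and> b \<in> carrier_vec d \<and> lambda_max A = L \<and>
        (let f = reg_quadratic A b s p; x_N = iterate d M f N in
          (\<exists>x_star. is_arg_min f (\<lambda>x. x \<in> carrier_vec d) x_star \<and>
             f x_N - f x_star \<ge> c * (L / (s powr (2 / p) * (real N)\<^sup>2)) powr (p / (p - 2))) \<and>
          enorm (gradient d f x_N)
             \<ge> c * (L / (s powr (1 / (p - 1)) * (real N)\<^sup>2)) powr ((p - 1) / (p - 2)))))"
proof -
  \<comment> \<open>\<open>K\<close> is the ratio from \<open>chain_tail_mass\<close>; being free of
    all parameters, it makes the constant of the theorem absolute.\<close>
  define K :: real where "K = 1 + 5 * exp 10"
  have K: "K \<ge> 1" by (simp add: K_def)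
  have "\<exists>A b. pos_semidef d A \<and> b \<in> carrier_vec d \<and> lambda_max A = L \<and>
        (let f = reg_quadratic A b s p; x_N = iterate d M f N in
          (\<exists>x_star. is_arg_min f (\<lambda>x. x \<in> carrier_vec d) x_star \<and>
             f x_N - f x_star \<ge> 1 / (2 * K) * (L / (s powr (2 / p) * (real N)\<^sup>2)) powr (p / (p - 2))) \<and>
          enorm (gradient d f x_N)
             \<ge> 1 / (2 * K) * (L / (s powr (1 / (p - 1)) * (real N)\<^sup>2)) powr ((p - 1) / (p - 2)))"
    if p: "p > 2" and s: "s > 0" and L: "L > 0" and N: "1 \<le> N" and dN: "real N \<le> (real d - 1) / 2"
      and M: "first_order_method d M"
    for p s L :: real and d N :: nat and M :: fo_method
  proof -
    have "real (2 * N + 1) \<le> real d" using dN by simp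
    then have d: "2 * N + 1 \<le> d" by (simp only: of_nat_le_iff)
    define \<mu> where "\<mu> = L / (real N)\<^sup>2"
    have \<mu>: "\<mu> > 0" using L N by (simp add: \<mu>_def)
    define R where "R = (\<mu> / s) powr (1 / (p - 2))"
    note R = regularized_scale[OF s \<mu> p, folded R_def]
    define S where "S = (\<Sum>i<Suc N. (chain_coeff N i)\<^sup>2)"
    have coeffN: "chain_coeff N N > 0"
      using N chain_weight_bounds(1)[OF N] by (simp add: chain_coeff_def)
    have S: "S > 0" using coeffN by (simp add: S_def add_nonneg_pos sum_nonneg)
    \<comment> \<open>\<open>sqrt S\<close> is the norm of the chain solution for every orthonormal
      \<open>V\<close>. So \<tau> and \<beta> are fixed before the basis, and the linear term
      depends on \<open>V\<close> through \<open>V 0\<close> only, as locality requires.\<close>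
    define \<tau> where "\<tau> = R / sqrt S"
    have \<tau>: "\<tau> > 0" using R(1) S by (simp add: \<tau>_def)
    define \<beta> where "\<beta> = \<tau> * (5 * L / (4 * real N) * chain_weight N 0)"
    define F where "F V = reg_quadratic (chain_mat d N L V) (\<beta> \<cdot>\<^sub>v V 0) s p" for V
    have b: "\<beta> \<cdot>\<^sub>v V 0 \<in> carrier_vec d" if "orthonormal d (Suc N) V" for V
      using that by (simp add: orthonormal_carrier)
    have grad: "gradient d (F V) x = reg_gradient (chain_mat d N L V) (\<beta> \<cdot>\<^sub>v V 0) s p x"
      if "orthonormal d (Suc N) V" "x \<in> carrier_vec d" for V x
      unfolding F_def using that L by (intro gradient_reg_quadratic_chain N p s b) auto
    have "\<exists>V. orthonormal d (Suc N) V \<and> iterate d M (F V) N \<in> carrier_vec d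
      \<and> V N \<bullet> iterate d M (F V) N = 0"
    proof (rule resisting_basis[OF M d])
      fix V and x :: "real vec" assume "orthonormal d (Suc N) V" "x \<in> carrier_vec d"
      then show "gradient d (F V) x \<in> carrier_vec d"
        by (auto simp only: grad intro!: reg_gradient_carrier chain_mat_carrier b)
    next
      fix V V' k and x :: "real vec"
      assume V: "orthonormal d (Suc N) V" and V': "orthonormal d (Suc N) V'" and x: "x \<in> carrier_vec d"
        and eq: "\<And>i. i \<le> k \<Longrightarrow> V i = V' i"
        and "\<And>i. k \<le> i \<Longrightarrow> i \<le> N \<Longrightarrow> V i \<bullet> x = 0" "\<And>i. k \<le> i \<Longrightarrow> i \<le> N \<Longrightarrow> V' i \<bullet> x = 0"
      then have "chain_mat d N L V *\<^sub>v x = chain_mat d N L V' *\<^sub>v x" by (intro chain_mat_local[where k = k]) auto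
      moreover have "V 0 = V' 0" using eq by simp
      ultimately show "fo_info d (F V) x = fo_info d (F V') x"
        unfolding fo_info_def grad[OF V x] grad[OF V' x]
        by (simp add: F_def reg_quadratic_def reg_gradient_def)
    qed
    then obtain V where V: "orthonormal d (Suc N) V" and xc: "iterate d M (F V) N \<in> carrier_vec d"
      and Vx: "V N \<bullet> iterate d M (F V) N = 0" by blast
    define A where "A = chain_mat d N L V"
    define x where "x = iterate d M (F V) N"
    define z where "z = lin_sum d (Suc N) (chain_coeff N) V"
    define y where "y = \<tau> \<cdot>\<^sub>v z"
    have x: "x \<in> carrier_vec d" and y: "y \<in> carrier_vec d" and VN: "V N \<in> carrier_vec d"
      using xc V by (auto simp: x_def y_def z_def orthonormal_carrier)
    have A: "pos_semidef d A" unfolding A_def using V L by (intro pos_semidef_chain_mat) auto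
    have nz: "enorm z = sqrt S"
      by (simp only: enorm_def z_def lin_sum_scalar_prod_self[OF V] S_def)
    then have \<tau>z: "\<tau> * enorm z = R" using S by (simp add: \<tau>_def)
    have ny: "enorm y = R" using \<tau> \<tau>z by (simp add: y_def enorm_smult)
    have stat: "reg_gradient A (\<beta> \<cdot>\<^sub>v V 0) s p y = 0\<^sub>v d"
      unfolding A_def \<beta>_def y_def z_def using \<tau> R(2) \<tau>z
      by (intro chain_stationary V N) (auto simp: z_def \<mu>_def)
    note bounds = stationary_residual_bounds[OF A b[OF V] p s _ y stat, unfolded ny R(2)]
    have FV: "F V = reg_quadratic A (\<beta> \<cdot>\<^sub>v V 0) s p" by (simp add: F_def A_def)
    have amin: "is_arg_min (F V) (\<lambda>x. x \<in> carrier_vec d) y"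
    proof -
      have "F V y \<le> F V u" if "u \<in> carrier_vec d" for u
      proof -
        have "0 \<le> \<mu> / 2 * (enorm (u - y))\<^sup>2" using \<mu> by simp
        also have "\<dots> \<le> F V u - F V y" unfolding FV using that by (rule bounds(1))
        finally show ?thesis by simp
      qed
      then show ?thesis using y by (auto simp: is_arg_min_def not_less)
    qed
    \<comment> \<open>The result of the method has no component along \<open>V N\<close>, so this
      coordinate of \<open>y\<close> alone bounds the distance from below.\<close>
    have "V N \<bullet> y = \<tau> * chain_coeff N N"
      using VN orthonormal_coordinate[OF V, of N "chain_coeff N"] by (simp add: y_def z_def)
    then have "\<tau> * chain_coeff N N = \<bar>V N \<bullet> (x - y)\<bar>"
      using VN x y Vx \<tau> coeffN by (simp add: scalar_prod_minus_distrib[of _ d] x_def)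
    also have "\<dots> \<le> enorm (V N) * enorm (x - y)"
      using VN x y by (intro scalar_prod_Cauchy_Schwarz[of _ d]) auto
    also have "enorm (V N) = 1" using V by (simp add: enorm_def orthonormal_def)
    finally have dist: "\<tau> * chain_coeff N N \<le> enorm (x - y)" by simp
    have "R\<^sup>2 = \<tau>\<^sup>2 * S" using S by (simp add: \<tau>_def power_divide)
    also have "\<dots> \<le> \<tau>\<^sup>2 * (K * (chain_coeff N N)\<^sup>2)"
      using chain_tail_mass[OF N] by (intro mult_left_mono) (auto simp: S_def K_def)
    also have "\<dots> = K * (\<tau> * chain_coeff N N)\<^sup>2" by (simp add: power_mult_distrib)
    also have "\<dots> \<le> K * (enorm (x - y))\<^sup>2"
      using dist \<tau> coeffN K by (intro mult_left_mono power_mono) auto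
    finally have far2: "R\<^sup>2 \<le> K * (enorm (x - y))\<^sup>2" .
    \<comment> \<open>Enlarging \<open>K\<close> to its square, possible since
      \<open>K \<ge> 1\<close>, lets the square root be taken and gives both bounds the same
      constant.\<close>
    also have "\<dots> \<le> K\<^sup>2 * (enorm (x - y))\<^sup>2"
      using K by (intro mult_right_mono) (auto simp: power2_eq_square)
    finally have "R\<^sup>2 \<le> (K * enorm (x - y))\<^sup>2" by (simp add: power_mult_distrib)
    then have far: "R \<le> K * enorm (x - y)"
      by (rule power2_le_imp_le) (use K enorm_nonneg in auto)
    have split: "L / (q * (real N)\<^sup>2) = \<mu> / q" for q by (simp add: \<mu>_def)
    have "1 / (2 * K) * (\<mu> * R\<^sup>2) \<le> 1 / (2 * K) * (\<mu> * (K * (enorm (x - y))\<^sup>2))"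
      using far2 \<mu> K by (intro mult_left_mono) auto
    also have "\<dots> = \<mu> / 2 * (enorm (x - y))\<^sup>2" using K by simp
    also have "\<dots> \<le> F V x - F V y" unfolding FV using x by (rule bounds(1))
    finally have gap: "1 / (2 * K) * (\<mu> * R\<^sup>2) \<le> F V x - F V y" .
    have "1 / (2 * K) * (\<mu> * R) \<le> 1 / (2 * K) * (\<mu> * (K * enorm (x - y)))"
      using far \<mu> K by (intro mult_left_mono) auto
    also have "\<dots> = \<mu> / 2 * enorm (x - y)" using K by simp
    also have "\<dots> \<le> enorm (gradient d (F V) x)"
      unfolding grad[OF V x] A_def[symmetric] using x by (rule bounds(2))
    finally have gradient: "1 / (2 * K) * (\<mu> * R) \<le> enorm (gradient d (F V) x)" .
    have "lambda_max A = L"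
      unfolding A_def using V N d L by (intro lambda_max_chain_mat) auto
    then show ?thesis
      unfolding Let_def split R(3,4)
      using A b[OF V] amin gap gradient unfolding FV[symmetric] x_def
      by (intro exI[of _ A] exI[of _ "\<beta> \<cdot>\<^sub>v V 0"]) (auto simp: FV[symmetric])
  qed
  moreover have "1 / (2 * K) > 0" using K by simp
  ultimately show ?thesis by blast
qed

end
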